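(* Let $G$ be a finite supersolvable group and let $A$, $B$ and $D$ be conjugacy classes of $G$ such that $D\subseteq AB$. Then $$\operatorname{dl}\bigl({\bf C}_G(D)/({\bf C}_G(A)\cap{\bf C}_G(B))\bigr)\leq 2\,\eta(AB).$$
   Context: For subsets $A,B$ of $G$, $AB=\{xy\mid x\in A,\ y\in B\}$. If $A$ and $B$ are conjugacy classes of the finite group $G$, then $AB$ is closed under conjugation by $G$, hence is a union of conjugacy classes of $G$; $\eta(AB)$ denotes the number of distinct conjugacy classes of $G$ whose union is $AB$. For a subset $X$ of $G$, ${\bf C}_G(X)=\{g\in G\mid g^{-1}xg=x\text{ for all }x\in X\}$ is the centralizer of $X$ in $G$. Since $D$ is a conjugacy class contained in $AB$, the normal subgroup ${\bf C}_G(A)\cap{\bf C}_G(B)$ is contained in ${\bf C}_G(D)$. For a solvable group $H$, $\operatorname{dl}(H)$ denotes its derived length. *)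

theory Defs
  imports "HOL-Algebra.Algebra" "HOL-Library.Extended_Nat"
begin

definition conj_class :: "('a, 'b) monoid_scheme \<Rightarrow> 'a \<Rightarrow> 'a set" where
  "conj_class G x = (\<lambda>g. inv\<^bsub>G\<^esub> g \<otimes>\<^bsub>G\<^esub> x \<otimes>\<^bsub>G\<^esub> g) ` carrier G"

definition conj_classes :: "('a, 'b) monoid_scheme \<Rightarrow> 'a set set" where
  "conj_classes G = conj_class G ` carrier G"

definition centralizer :: "('a, 'b) monoid_scheme \<Rightarrow> 'a set \<Rightarrow> 'a set" where
  "centralizer G S = {g \<in> carrier G. \<forall>x\<in>S. inv\<^bsub>G\<^esub> g \<otimes>\<^bsub>G\<^esub> x \<otimes>\<^bsub>G\<^esub> g = x}"

(* Meant for conjugation-invariant S. The lemmas conj_classes_Union and eta_unique below show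
   that for S = AB this counts the unique family of conjugacy classes whose union is AB. *)
definition eta :: "('a, 'b) monoid_scheme \<Rightarrow> 'a set \<Rightarrow> nat" where
  "eta G S = card {C \<in> conj_classes G. C \<subseteq> S}"

(* All terms of the series are normal in the whole group, not merely in the next term. *)
definition supersolvable :: "('a, 'b) monoid_scheme \<Rightarrow> bool" where
  "supersolvable G \<longleftrightarrow> group G \<and>
     (\<exists>(n::nat) N. N 0 = {\<one>\<^bsub>G\<^esub>} \<and> N n = carrier G \<and> (\<forall>i\<le>n. N i \<lhd> G) \<and>
        (\<forall>i<n. N i \<subseteq> N (Suc i) \<and> cyclic_group (G\<lparr>carrier := N (Suc i)\<rparr> Mod N i)))"

(* The least n such that the n-th derived subgroup is trivial; infinity (the infimum of the
   empty set) if the group is not solvable, so a finite bound on it entails solvability. *)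
definition derived_length :: "('a, 'b) monoid_scheme \<Rightarrow> enat" where
  "derived_length G = (INF n \<in> {n. (derived G ^^ n) (carrier G) = {\<one>\<^bsub>G\<^esub>}}. enat n)"

context group
begin

lemma derived_length_solvable: "derived_length G \<noteq> \<infinity> \<longleftrightarrow> solvable G"
proof
  assume "derived_length G \<noteq> \<infinity>"
  then have "{n. (derived G ^^ n) (carrier G) = {\<one>}} \<noteq> {}"
    unfolding derived_length_def by (intro notI) (simp add: top_enat_def)
  then show "solvable G"
    using solvable_iff_trivial_derived_seq by blast
next
  assume "solvable G"
  then obtain n where "(derived G ^^ n) (carrier G) = {\<one>}"
    using solvable_iff_trivial_derived_seq by blast
  then have "derived_length G \<le> enat n"
    unfolding derived_length_def by (intro INF_lower) simp
  then show "derived_length G \<noteq> \<infinity>"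
    by (metis enat_ord_simps(5) enat.distinct(1))
qed

lemma conj_mult:
  assumes "g \<in> carrier G" "x \<in> carrier G" "y \<in> carrier G"
  shows "inv g \<otimes> (x \<otimes> y) \<otimes> g = (inv g \<otimes> x \<otimes> g) \<otimes> (inv g \<otimes> y \<otimes> g)"
proof -
  have "g \<otimes> (inv g \<otimes> z) = z" if "z \<in> carrier G" for z
    using assms(1) that by (simp flip: m_assoc)
  then show ?thesis
    using assms by (simp add: m_assoc)
qed

lemma conj_conj:
  assumes "g \<in> carrier G" "h \<in> carrier G" "x \<in> carrier G"
  shows "inv h \<otimes> (inv g \<otimes> x \<otimes> g) \<otimes> h = inv (g \<otimes> h) \<otimes> x \<otimes> (g \<otimes> h)"
  using assms by (simp add: m_assoc inv_mult_group)

lemma conj_class_self: "x \<in> carrier G \<Longrightarrow> x \<in> conj_class G x"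
  unfolding conj_class_def by (rule image_eqI[of _ _ \<one>]) auto

lemma conj_class_closed:
  assumes "C \<in> conj_classes G" "x \<in> C" "g \<in> carrier G"
  shows "inv g \<otimes> x \<otimes> g \<in> C"
  using assms unfolding conj_classes_def conj_class_def
  by (auto simp: conj_conj)

lemma conj_classes_subset: "C \<in> conj_classes G \<Longrightarrow> C \<subseteq> carrier G"
  unfolding conj_classes_def conj_class_def by auto

lemma conj_class_eq:
  assumes "C \<in> conj_classes G" "x \<in> C"
  shows "C = conj_class G x"
proof -
  obtain y where y: "y \<in> carrier G" "C = conj_class G y"
    using assms(1) unfolding conj_classes_def by auto
  then obtain g where g: "g \<in> carrier G" "x = inv g \<otimes> y \<otimes> g"
    using assms(2) unfolding conj_class_def by auto
  have "inv h \<otimes> y \<otimes> h \<in> conj_class G x" if h: "h \<in> carrier G" for h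
  proof -
    have "inv (inv g \<otimes> h) \<otimes> x \<otimes> (inv g \<otimes> h) = inv (g \<otimes> (inv g \<otimes> h)) \<otimes> y \<otimes> (g \<otimes> (inv g \<otimes> h))"
      unfolding g(2) using g(1) h y(1) by (intro conj_conj) auto
    also have "g \<otimes> (inv g \<otimes> h) = h"
      using g(1) h by (simp flip: m_assoc)
    finally show ?thesis
      unfolding conj_class_def using g(1) h by (intro image_eqI[of _ _ "inv g \<otimes> h"]) auto
  qed
  then have "C \<subseteq> conj_class G x"
    unfolding y(2) conj_class_def[of G y] by auto
  moreover have "conj_class G x \<subseteq> C"
    using conj_class_closed[OF assms] unfolding conj_class_def by auto
  ultimately show ?thesis by auto
qed

lemma eta_unique:
  assumes "F \<subseteq> conj_classes G" "\<Union>F = S"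
  shows "eta G S = card F"
proof -
  have "C \<in> F" if C: "C \<in> conj_classes G" "C \<subseteq> S" for C
  proof -
    obtain x where x: "x \<in> C"
      using C(1) conj_class_self unfolding conj_classes_def by auto
    then obtain C' where "C' \<in> F" "x \<in> C'"
      using C(2) assms(2) by auto
    then show ?thesis
      using conj_class_eq[OF C(1) x] conj_class_eq[of C' x] assms(1) by auto
  qed
  then have "{C \<in> conj_classes G. C \<subseteq> S} = F"
    using assms by auto
  then show ?thesis
    by (simp add: eta_def)
qed

lemma conj_classes_Union:
  assumes "A \<in> conj_classes G" "B \<in> conj_classes G"
  shows "\<Union>{C \<in> conj_classes G. C \<subseteq> A <#> B} = A <#> B"
proof -
  have "\<exists>C \<in> conj_classes G. C \<subseteq> A <#> B \<and> z \<in> C" if "z \<in> A <#> B" for z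
  proof -
    obtain a b where ab: "a \<in> A" "b \<in> B" "z = a \<otimes> b"
      using \<open>z \<in> A <#> B\<close> unfolding set_mult_def by auto
    then have car: "a \<in> carrier G" "b \<in> carrier G"
      using assms conj_classes_subset by auto
    have "inv g \<otimes> z \<otimes> g \<in> A <#> B" if g: "g \<in> carrier G" for g
      using conj_class_closed[OF assms(1) ab(1) g] conj_class_closed[OF assms(2) ab(2) g]
      unfolding ab(3) conj_mult[OF g car] set_mult_def by auto
    then have "conj_class G z \<subseteq> A <#> B"
      unfolding conj_class_def by auto
    then show ?thesis
      using car ab(3) conj_class_self[of z] unfolding conj_classes_def by auto
  qed
  then show ?thesis by auto
qed

lemma centralizer_Int_subset:
  assumes "A \<in> conj_classes G" "B \<in> conj_classes G" "D \<subseteq> A <#> B"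
  shows "centralizer G A \<inter> centralizer G B \<subseteq> centralizer G D"
proof
  fix g assume g: "g \<in> centralizer G A \<inter> centralizer G B"
  then have gc: "g \<in> carrier G"
    by (simp add: centralizer_def)
  have "inv g \<otimes> x \<otimes> g = x" if "x \<in> D" for x
  proof -
    obtain a b where ab: "a \<in> A" "b \<in> B" "x = a \<otimes> b"
      using \<open>x \<in> D\<close> assms(3) unfolding set_mult_def by auto
    then have "a \<in> carrier G" "b \<in> carrier G"
      using assms conj_classes_subset by auto
    then show ?thesis
      using g ab conj_mult[OF gc] by (simp add: centralizer_def)
  qed
  then show "g \<in> centralizer G D"
    using gc by (simp add: centralizer_def)
qed

lemma centralizer_conj_class_normal:
  assumes "A \<in> conj_classes G"
  shows "centralizer G A \<lhd> G"
proof -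
  note sub = conj_classes_subset[OF assms]
  have cen: "g \<in> centralizer G A \<longleftrightarrow> g \<in> carrier G \<and> (\<forall>x\<in>A. x \<otimes> g = g \<otimes> x)" for g
  proof -
    have "inv g \<otimes> x \<otimes> g = x \<longleftrightarrow> x \<otimes> g = g \<otimes> x" if "g \<in> carrier G" "x \<in> A" for x
      using that sub by (metis inv_closed inv_solve_left m_assoc m_closed subsetD)
    then show ?thesis
      unfolding centralizer_def by auto
  qed
  have "subgroup (centralizer G A) G"
  proof (rule subgroupI)
    show "centralizer G A \<subseteq> carrier G" using cen by auto
    show "centralizer G A \<noteq> {}" using cen[of \<one>] sub by auto
  next
    fix g assume g: "g \<in> centralizer G A"
    have "x \<otimes> inv g = inv g \<otimes> x" if "x \<in> A" for x
    proof -
      have c: "x \<in> carrier G" "g \<in> carrier G" "x \<otimes> g = g \<otimes> x"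
        using that g sub cen by auto
      have "x \<otimes> inv g = inv g \<otimes> (g \<otimes> x) \<otimes> inv g"
        using c(1,2) by (simp flip: m_assoc)
      also have "\<dots> = inv g \<otimes> (x \<otimes> g) \<otimes> inv g"
        by (simp only: c(3))
      also have "\<dots> = inv g \<otimes> x"
        using c(1,2) by (simp add: m_assoc)
      finally show ?thesis .
    qed
    then show "inv g \<in> centralizer G A" using g cen by auto
  next
    fix g h assume gh: "g \<in> centralizer G A" "h \<in> centralizer G A"
    have "x \<otimes> (g \<otimes> h) = (g \<otimes> h) \<otimes> x" if "x \<in> A" for x
    proof -
      have c: "x \<in> carrier G" "g \<in> carrier G" "h \<in> carrier G"
          "x \<otimes> g = g \<otimes> x" "x \<otimes> h = h \<otimes> x"
        using that gh sub cen by auto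
      have "x \<otimes> (g \<otimes> h) = g \<otimes> (x \<otimes> h)"
        using c(1-3) by (simp add: c(4) flip: m_assoc)
      also have "\<dots> = g \<otimes> h \<otimes> x"
        using c(1-3) by (simp add: c(5) m_assoc)
      finally show ?thesis .
    qed
    then show "g \<otimes> h \<in> centralizer G A" using gh cen by auto
  qed
  moreover have "x \<otimes> g \<otimes> inv x \<in> centralizer G A"
    if x: "x \<in> carrier G" and g: "g \<in> centralizer G A" for x g
  proof -
    have gc: "g \<in> carrier G" using g cen by auto
    have "y \<otimes> (x \<otimes> g \<otimes> inv x) = (x \<otimes> g \<otimes> inv x) \<otimes> y" if y: "y \<in> A" for y
    proof -
      have yc: "y \<in> carrier G" using y sub by auto
      let ?z = "inv x \<otimes> y \<otimes> x"
      have comm: "?z \<otimes> g = g \<otimes> ?z"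
        using conj_class_closed[OF assms y x] g cen by auto
      have "y \<otimes> (x \<otimes> g \<otimes> inv x) = x \<otimes> (?z \<otimes> g) \<otimes> inv x"
        using x yc gc by (simp flip: m_assoc)
      also have "\<dots> = x \<otimes> (g \<otimes> ?z) \<otimes> inv x"
        by (simp only: comm)
      also have "\<dots> = x \<otimes> g \<otimes> inv x \<otimes> y"
        using x yc gc by (simp add: m_assoc)
      finally show ?thesis .
    qed
    then show ?thesis using x gc cen by auto
  qed
  ultimately show ?thesis
    unfolding normal_inv_iff by auto
qed

lemma centralizer_Int_normal:
  assumes "A \<in> conj_classes G" "B \<in> conj_classes G" "D \<in> conj_classes G" "D \<subseteq> A <#> B"
  shows "centralizer G A \<inter> centralizer G B \<lhd> G\<lparr>carrier := centralizer G D\<rparr>"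
proof (rule normal_restrict_supergroup)
  show "subgroup (centralizer G D) G"
    using centralizer_conj_class_normal[OF assms(3)] by (rule normal_imp_subgroup)
  show "centralizer G A \<inter> centralizer G B \<lhd> G"
    using assms(1,2) by (intro normal_subgroup_intersect centralizer_conj_class_normal)
  show "centralizer G A \<inter> centralizer G B \<subseteq> centralizer G D"
    using assms(1,2,4) by (rule centralizer_Int_subset)
qed

end

end

theory Submission
  imports Defs
begin

text \<open>
  Let \<open>C\<close> be the centralizer of \<open>D\<close> and \<open>1 = N\<^sub>0 \<le> \<dots> \<le> N\<^sub>n = G\<close> a normal series with cyclic factors.
  Going down the series, we track the elements \<open>g \<in> C\<close> centralizing \<open>B\<close> modulo \<open>N\<^sub>i\<close>, that is, with all
  \<open>[y, g] = y\<inverse> y\<^sup>g\<close> (\<open>y \<in> B\<close>) in \<open>N\<^sub>i\<close>, and the classes in \<open>AB\<close> that are contained in \<open>D N\<^sub>i\<close>.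

  If \<open>x y \<in> D\<close> and \<open>[y, g] \<in> N\<^sub>m\<close>, then \<open>x y\<^sup>g = (x y) [y, g]\<close> lies in a class in \<open>AB\<close> contained in \<open>D N\<^sub>m\<close>.
  Where no such class is lost between \<open>N\<^sub>m\<close> and \<open>N\<^sub>i\<close>, \<open>[y, g]\<close> lies in \<open>D\<inverse> D N\<^sub>i\<close> and thus commutes with
  \<open>C\<close> modulo \<open>N\<^sub>i\<close>; hence a single derived step leads from \<open>N\<^sub>m\<close> down to \<open>N\<^sub>i\<close>, however long the gap.
  Where classes are lost, from \<open>N\<^sub>i\<^sub>+\<^sub>1\<close> to \<open>N\<^sub>i\<close>, one derived step suffices for elements of the derived
  subgroup of \<open>G\<close>, as these act trivially on all cyclic factors. Since \<open>D\<close> is never lost, there are at most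
  \<open>\<eta>(AB) - 1\<close> losses and \<open>\<eta>(AB)\<close> gaps; with one initial step into the derived subgroup, this makes
  \<open>2 \<eta>(AB)\<close> steps. An element of \<open>C\<close> centralizing \<open>B\<close> also centralizes \<open>A\<close>.
\<close>

definition commute_mod :: "('a, 'b) monoid_scheme \<Rightarrow> 'a set \<Rightarrow> 'a \<Rightarrow> 'a \<Rightarrow> bool" where
  "commute_mod G M x y \<longleftrightarrow> M #>\<^bsub>G\<^esub> (x \<otimes>\<^bsub>G\<^esub> y) = M #>\<^bsub>G\<^esub> (y \<otimes>\<^bsub>G\<^esub> x)"

text \<open>For normal \<open>M\<close> this is the preimage in \<open>G\<close> of the centralizer
  of the coset of \<open>y\<close> in \<open>G Mod M\<close>.\<close>

definition centralizer_mod :: "('a, 'b) monoid_scheme \<Rightarrow> 'a set \<Rightarrow> 'a \<Rightarrow> 'a set" where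
  "centralizer_mod G M y = {g \<in> carrier G. commute_mod G M y g}"

lemma commute_mod_sym: "commute_mod G M x y \<longleftrightarrow> commute_mod G M y x"
  unfolding commute_mod_def by auto

context group
begin

section \<open>Commutators that fix an element under conjugation\<close>

lemma conj_eq_iff:
  assumes "x \<in> carrier G" "g \<in> carrier G" "z \<in> carrier G"
  shows "inv g \<otimes> x \<otimes> g = z \<longleftrightarrow> x \<otimes> g = g \<otimes> z"
  using assms by (metis inv_closed inv_solve_left m_assoc m_closed)

lemma conj_move:
  assumes c: "x \<in> carrier G" "w \<in> carrier G" "z \<in> carrier G" and eq: "x \<otimes> w = w \<otimes> z"
  shows "z \<otimes> inv w = inv w \<otimes> x"
proof -
  have "z \<otimes> inv w = inv w \<otimes> (w \<otimes> z) \<otimes> inv w"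
    using c by (simp flip: m_assoc)
  also have "\<dots> = inv w \<otimes> x"
    unfolding eq[symmetric] using c by (simp add: m_assoc)
  finally show ?thesis .
qed

text \<open>The commutator is \<open>(g \<otimes> h) \<otimes> inv (h \<otimes> g)\<close>:
  conjugating by the first factor takes \<open>x\<close> to some \<open>z\<close>, and conjugating
  by the second takes the same \<open>z\<close> back to \<open>x\<close>.\<close>

lemma commutator_commutes:
  assumes c: "x \<in> carrier G" "g \<in> carrier G" "h \<in> carrier G"
    and eq: "inv (g \<otimes> h) \<otimes> x \<otimes> (g \<otimes> h) = inv (h \<otimes> g) \<otimes> x \<otimes> (h \<otimes> g)"
  shows "x \<otimes> (g \<otimes> h \<otimes> inv g \<otimes> inv h) = (g \<otimes> h \<otimes> inv g \<otimes> inv h) \<otimes> x"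
proof -
  define z where "z = inv (g \<otimes> h) \<otimes> x \<otimes> (g \<otimes> h)"
  have z: "z \<in> carrier G" using c by (simp add: z_def)
  have 1: "x \<otimes> (g \<otimes> h) = (g \<otimes> h) \<otimes> z"
    using conj_eq_iff[of x "g \<otimes> h" z] c z z_def by auto
  have 2: "x \<otimes> (h \<otimes> g) = (h \<otimes> g) \<otimes> z"
    using conj_eq_iff[of x "h \<otimes> g" z] c z z_def eq by auto
  have "x \<otimes> (g \<otimes> h \<otimes> inv g \<otimes> inv h) = (x \<otimes> (g \<otimes> h)) \<otimes> inv (h \<otimes> g)"
    using c by (simp add: m_assoc inv_mult_group)
  also have "\<dots> = (g \<otimes> h) \<otimes> (z \<otimes> inv (h \<otimes> g))"
    using c z by (simp add: 1 m_assoc)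
  also have "z \<otimes> inv (h \<otimes> g) = inv (h \<otimes> g) \<otimes> x"
    by (rule conj_move) (use c z 2 in simp_all)
  finally show ?thesis
    using c by (simp add: m_assoc inv_mult_group)
qed

text \<open>On the powers of \<open>x\<close> both conjugations act as power maps, and these commute
  because exponents multiply.\<close>

lemma commutator_commutes_int_pow:
  fixes k l :: int
  assumes c: "x \<in> carrier G" "g \<in> carrier G" "h \<in> carrier G"
    and gk: "inv g \<otimes> x \<otimes> g = x [^] k" and hl: "inv h \<otimes> x \<otimes> h = x [^] l"
  shows "x \<otimes> (g \<otimes> h \<otimes> inv g \<otimes> inv h) = (g \<otimes> h \<otimes> inv g \<otimes> inv h) \<otimes> x"
proof (rule commutator_commutes[OF c])
  have pw: "inv t \<otimes> (x [^] n) \<otimes> t = (inv t \<otimes> x \<otimes> t) [^] n" if t: "t \<in> carrier G" for t and n :: int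
  proof -
    have "(\<lambda>z. inv t \<otimes> z \<otimes> t) \<in> hom G G"
      using t conj_mult by (auto simp: hom_def)
    then interpret conj: group_hom G G "\<lambda>z. inv t \<otimes> z \<otimes> t"
      by unfold_locales
    show ?thesis using conj.hom_int_pow[OF c(1)] .
  qed
  have "inv (g \<otimes> h) \<otimes> x \<otimes> (g \<otimes> h) = x [^] (l * k)"
    unfolding conj_conj[OF c(2,3,1), symmetric] gk pw[OF c(3)] hl int_pow_pow[OF c(1)] ..
  moreover have "inv (h \<otimes> g) \<otimes> x \<otimes> (h \<otimes> g) = x [^] (k * l)"
    unfolding conj_conj[OF c(3,2,1), symmetric] hl pw[OF c(2)] gk int_pow_pow[OF c(1)] ..
  ultimately show "inv (g \<otimes> h) \<otimes> x \<otimes> (g \<otimes> h) = inv (h \<otimes> g) \<otimes> x \<otimes> (h \<otimes> g)"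
    by (simp add: mult.commute)
qed

text \<open>Conjugation by \<open>g\<close> turns \<open>x\<close> into \<open>x \<otimes> u\<close>
  and fixes \<open>v\<close>; conjugation by \<open>h\<close> turns \<open>x\<close> into
  \<open>x \<otimes> v\<close> and fixes \<open>u\<close>. As \<open>u\<close> and \<open>v\<close>
  commute, the order of the two does not matter.\<close>

lemma commutator_commutes_translation:
  assumes c: "x \<in> carrier G" "g \<in> carrier G" "h \<in> carrier G"
    and u: "u = inv x \<otimes> inv g \<otimes> x \<otimes> g" and v: "v = inv x \<otimes> inv h \<otimes> x \<otimes> h"
    and uh: "u \<otimes> h = h \<otimes> u" and vg: "v \<otimes> g = g \<otimes> v" and uv: "u \<otimes> v = v \<otimes> u"
  shows "x \<otimes> (g \<otimes> h \<otimes> inv g \<otimes> inv h) = (g \<otimes> h \<otimes> inv g \<otimes> inv h) \<otimes> x"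
proof (rule commutator_commutes[OF c])
  have uc: "u \<in> carrier G" "v \<in> carrier G" using u v c by auto
  have cancel: "x \<otimes> (inv x \<otimes> z) = z" if "z \<in> carrier G" for z
    using c(1) that by (simp flip: m_assoc)
  have gu: "inv g \<otimes> x \<otimes> g = x \<otimes> u"
    unfolding u using c cancel by (simp add: m_assoc)
  have hv: "inv h \<otimes> x \<otimes> h = x \<otimes> v"
    unfolding v using c cancel by (simp add: m_assoc)
  have "inv (g \<otimes> h) \<otimes> x \<otimes> (g \<otimes> h) = x \<otimes> v \<otimes> u"
    unfolding conj_conj[OF c(2,3,1), symmetric] gu conj_mult[OF c(3,1) uc(1)] hv
    using conj_eq_iff[OF uc(1) c(3) uc(1)] uh by simp
  moreover have "inv (h \<otimes> g) \<otimes> x \<otimes> (h \<otimes> g) = x \<otimes> u \<otimes> v"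
    unfolding conj_conj[OF c(3,2,1), symmetric] hv conj_mult[OF c(2,1) uc(2)] gu
    using conj_eq_iff[OF uc(2) c(2) uc(2)] vg by simp
  ultimately show "inv (g \<otimes> h) \<otimes> x \<otimes> (g \<otimes> h) = inv (h \<otimes> g) \<otimes> x \<otimes> (h \<otimes> g)"
    using c uc uv by (simp add: m_assoc)
qed

section \<open>Commuting modulo a normal subgroup\<close>

lemma group_hom_Mod: "M \<lhd> G \<Longrightarrow> group_hom G (G Mod M) (\<lambda>x. M #> x)"
  by (simp add: group_hom_def group_hom_axioms_def normal.factorgroup_is_group
      normal.r_coset_hom_Mod is_group)

text \<open>Normality turns the right cosets into left ones, so that the criterion takes the shape
  \<open>inv x \<otimes> y\<close>, which fits the commutators \<open>[y, g]\<close>.\<close>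

lemma rcos_eq_iff:
  assumes "M \<lhd> G" "x \<in> carrier G" "y \<in> carrier G"
  shows "M #> x = M #> y \<longleftrightarrow> inv x \<otimes> y \<in> M"
proof -
  interpret normal M G by fact
  have "M #> x = M #> y \<longleftrightarrow> y \<in> M #> x"
    using assms repr_independence repr_independenceD is_subgroup by metis
  also have "\<dots> \<longleftrightarrow> y \<in> x <# M"
    using coset_eq assms by auto
  also have "\<dots> \<longleftrightarrow> inv x \<otimes> y \<in> M"
  proof
    assume "y \<in> x <# M"
    then obtain m where "m \<in> M" "y = x \<otimes> m" unfolding l_coset_def by auto
    then show "inv x \<otimes> y \<in> M" using assms(2) by (simp add: subset m_assoc[symmetric])
  next
    assume m: "inv x \<otimes> y \<in> M"
    have "y = x \<otimes> (inv x \<otimes> y)" using assms(2,3) by (simp add: m_assoc[symmetric])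
    then show "y \<in> x <# M" using m unfolding l_coset_def by blast
  qed
  finally show ?thesis .
qed

lemma commute_mod_iff:
  assumes "M \<lhd> G" "x \<in> carrier G" "y \<in> carrier G"
  shows "commute_mod G M x y \<longleftrightarrow> inv x \<otimes> inv y \<otimes> x \<otimes> y \<in> M"
proof -
  have "commute_mod G M x y \<longleftrightarrow> M #> (y \<otimes> x) = M #> (x \<otimes> y)"
    by (auto simp: commute_mod_def)
  also have "\<dots> \<longleftrightarrow> inv x \<otimes> inv y \<otimes> x \<otimes> y \<in> M"
    using assms by (simp add: rcos_eq_iff inv_mult_group m_assoc)
  finally show ?thesis .
qed

lemma commute_mod_Mod:
  assumes "M \<lhd> G" "x \<in> carrier G" "y \<in> carrier G"
  shows "commute_mod G M x y \<longleftrightarrow>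
    (M #> x) \<otimes>\<^bsub>G Mod M\<^esub> (M #> y) = (M #> y) \<otimes>\<^bsub>G Mod M\<^esub> (M #> x)"
proof -
  interpret Q: group_hom G "G Mod M" "\<lambda>x. M #> x" by (rule group_hom_Mod) fact
  show ?thesis using assms unfolding commute_mod_def by simp
qed

lemma subgroup_centralizer_mod:
  assumes M: "M \<lhd> G" and y: "y \<in> carrier G"
  shows "subgroup (centralizer_mod G M y) G"
proof -
  interpret Q: group_hom G "G Mod M" "\<lambda>x. M #> x" by (rule group_hom_Mod) fact
  have mem: "g \<in> centralizer_mod G M y \<longleftrightarrow> g \<in> carrier G \<and>
     (M #> y) \<otimes>\<^bsub>G Mod M\<^esub> (M #> g) = (M #> g) \<otimes>\<^bsub>G Mod M\<^esub> (M #> y)" for g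
    using commute_mod_Mod[OF M y] unfolding centralizer_mod_def by auto
  show ?thesis
  proof (rule subgroupI)
    show "centralizer_mod G M y \<subseteq> carrier G" by (auto simp: centralizer_mod_def)
    have "\<one> \<in> centralizer_mod G M y" using y by (simp add: centralizer_mod_def commute_mod_def)
    then show "centralizer_mod G M y \<noteq> {}" by auto
  next
    fix a assume "a \<in> centralizer_mod G M y"
    then have a: "a \<in> carrier G" "(M #> y) \<otimes>\<^bsub>G Mod M\<^esub> (M #> a) = (M #> a) \<otimes>\<^bsub>G Mod M\<^esub> (M #> y)"
      using mem by auto
    then have "(M #> y) \<otimes>\<^bsub>G Mod M\<^esub> inv\<^bsub>G Mod M\<^esub> (M #> a) = inv\<^bsub>G Mod M\<^esub> (M #> a) \<otimes>\<^bsub>G Mod M\<^esub> (M #> y)"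
      using y a(1) Q.H.conj_move[of "M #> y" "M #> a" "M #> y"] by simp
    then show "inv a \<in> centralizer_mod G M y" using a mem by simp
  next
    fix a b assume "a \<in> centralizer_mod G M y" "b \<in> centralizer_mod G M y"
    then have a: "a \<in> carrier G" "(M #> y) \<otimes>\<^bsub>G Mod M\<^esub> (M #> a) = (M #> a) \<otimes>\<^bsub>G Mod M\<^esub> (M #> y)"
      and b: "b \<in> carrier G" "(M #> y) \<otimes>\<^bsub>G Mod M\<^esub> (M #> b) = (M #> b) \<otimes>\<^bsub>G Mod M\<^esub> (M #> y)"
      using mem by auto
    have "(M #> y) \<otimes>\<^bsub>G Mod M\<^esub> ((M #> a) \<otimes>\<^bsub>G Mod M\<^esub> (M #> b)) =
       ((M #> a) \<otimes>\<^bsub>G Mod M\<^esub> (M #> b)) \<otimes>\<^bsub>G Mod M\<^esub> (M #> y)"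
      using a b y Q.hom_closed Q.H.m_assoc by metis
    then show "a \<otimes> b \<in> centralizer_mod G M y" using a b mem by simp
  qed
qed

lemma derived_subset_centralizer_mod:
  assumes M: "M \<lhd> G" and y: "y \<in> carrier G" and L: "L \<subseteq> carrier G"
    and comm: "\<And>g h. g \<in> L \<Longrightarrow> h \<in> L \<Longrightarrow> commute_mod G M y (g \<otimes> h \<otimes> inv g \<otimes> inv h)"
  shows "derived G L \<subseteq> centralizer_mod G M y"
  unfolding derived_def
proof (rule generate_subgroup_incl[OF _ subgroup_centralizer_mod[OF M y]])
  show "derived_set G L \<subseteq> centralizer_mod G M y"
    using comm L by (auto simp: centralizer_mod_def subset_iff)
qed

text \<open>Common core of both kinds of descent. Modulo \<open>M\<close>, each \<open>g\<close> in
  \<open>L\<close> multiplies \<open>y\<close> by \<open>[y, g]\<close>; these factors are fixed by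
  \<open>L\<close> and commute with each other, so commutators of \<open>L\<close> fix
  \<open>y\<close>.\<close>

lemma derived_centralizes_translation:
  assumes M: "M \<lhd> G" and y: "y \<in> carrier G" and L: "L \<subseteq> carrier G"
    and comm: "\<And>g h. g \<in> L \<Longrightarrow> h \<in> L \<Longrightarrow> commute_mod G M (inv y \<otimes> inv g \<otimes> y \<otimes> g) h"
    and comm': "\<And>g h. g \<in> L \<Longrightarrow> h \<in> L \<Longrightarrow>
      commute_mod G M (inv y \<otimes> inv g \<otimes> y \<otimes> g) (inv y \<otimes> inv h \<otimes> y \<otimes> h)"
  shows "derived G L \<subseteq> centralizer_mod G M y"
proof (rule derived_subset_centralizer_mod[OF M y L])
  fix g h assume gh: "g \<in> L" "h \<in> L"
  then have c: "g \<in> carrier G" "h \<in> carrier G" using L by auto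
  interpret Q: group_hom G "G Mod M" "\<lambda>x. M #> x" by (rule group_hom_Mod) fact
  show "commute_mod G M y (g \<otimes> h \<otimes> inv g \<otimes> inv h)"
    using Q.H.commutator_commutes_translation[of "M #> y" "M #> g" "M #> h", OF _ _ _ refl refl]
      comm[OF gh] comm[OF gh(2,1)] comm'[OF gh] c y
    by (simp add: commute_mod_Mod[OF M])
qed

section \<open>Action on cyclic factors\<close>

text \<open>Moves a generator from the quotient of the group on \<open>N\<close> to
  \<open>G Mod M\<close>, where conjugation by elements outside \<open>N\<close> is
  available.\<close>

lemma cyclic_Mod_generator:
  assumes M: "M \<lhd> G" and N: "N \<lhd> G" and MN: "M \<subseteq> N"
    and cyc: "cyclic_group (G\<lparr>carrier := N\<rparr> Mod M)"
  obtains z where "z \<in> N" "\<And>t. t \<in> N \<Longrightarrow> \<exists>k::int. M #> t = (M #> z) [^]\<^bsub>G Mod M\<^esub> k"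
proof -
  have sN: "subgroup N G" using N by (rule normal_imp_subgroup)
  have MN': "M \<lhd> G\<lparr>carrier := N\<rparr>"
    using normal_restrict_supergroup[OF sN M MN] .
  interpret R: group "G\<lparr>carrier := N\<rparr>" using sN by (rule subgroup_imp_group)
  interpret Q: group_hom G "G Mod M" "\<lambda>x. M #> x" by (rule group_hom_Mod) fact
  interpret S: group_hom "G\<lparr>carrier := N\<rparr>" "G\<lparr>carrier := N\<rparr> Mod M" "\<lambda>x. M #> x"
    using R.group_hom_Mod[OF MN'] by (simp add: r_coset_def)
  obtain Z where Z: "Z \<in> carrier (G\<lparr>carrier := N\<rparr> Mod M)"
    "carrier (G\<lparr>carrier := N\<rparr> Mod M) = range (\<lambda>n::int. Z [^]\<^bsub>G\<lparr>carrier := N\<rparr> Mod M\<^esub> n)"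
    using cyc S.H.cyclic_group by blast
  obtain z where z: "z \<in> N" "Z = M #> z"
    using Z(1) by (auto simp: FactGroup_def RCOSETS_def r_coset_def)
  have "\<exists>k::int. M #> t = (M #> z) [^]\<^bsub>G Mod M\<^esub> k" if "t \<in> N" for t
  proof -
    have "M #> t \<in> carrier (G\<lparr>carrier := N\<rparr> Mod M)"
      using S.hom_closed[of t] that by simp
    then obtain k :: int where k: "M #> t = Z [^]\<^bsub>G\<lparr>carrier := N\<rparr> Mod M\<^esub> k"
      using Z(2) by auto
    have "Z [^]\<^bsub>G\<lparr>carrier := N\<rparr> Mod M\<^esub> k = M #> (z [^]\<^bsub>G\<lparr>carrier := N\<rparr>\<^esub> k)"
      using S.hom_int_pow[of z k] z by simp
    also have "z [^]\<^bsub>G\<lparr>carrier := N\<rparr>\<^esub> k = z [^] k"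
      using int_pow_consistent[OF sN z(1)] by simp
    also have "M #> (z [^] k) = (M #> z) [^]\<^bsub>G Mod M\<^esub> k"
      using Q.hom_int_pow z(1) sN subgroup.subset by blast
    finally show ?thesis using k by auto
  qed
  then show thesis using that z(1) by blast
qed

lemma cyclic_Mod_commute:
  assumes M: "M \<lhd> G" and N: "N \<lhd> G" and MN: "M \<subseteq> N"
    and cyc: "cyclic_group (G\<lparr>carrier := N\<rparr> Mod M)" and st: "s \<in> N" "t \<in> N"
  shows "commute_mod G M s t"
proof -
  interpret Q: group_hom G "G Mod M" "\<lambda>x. M #> x" by (rule group_hom_Mod) fact
  obtain z where z: "z \<in> N" "\<And>t. t \<in> N \<Longrightarrow> \<exists>k::int. M #> t = (M #> z) [^]\<^bsub>G Mod M\<^esub> k"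
    using cyclic_Mod_generator[OF M N MN cyc] by blast
  have c: "N \<subseteq> carrier G" using N normal_imp_subgroup subgroup.subset by blast
  obtain k :: int where k: "M #> s = (M #> z) [^]\<^bsub>G Mod M\<^esub> k" using z(2)[OF st(1)] ..
  obtain l :: int where l: "M #> t = (M #> z) [^]\<^bsub>G Mod M\<^esub> l" using z(2)[OF st(2)] ..
  have "(M #> s) \<otimes>\<^bsub>G Mod M\<^esub> (M #> t) = (M #> z) [^]\<^bsub>G Mod M\<^esub> (k + l)"
    "(M #> t) \<otimes>\<^bsub>G Mod M\<^esub> (M #> s) = (M #> z) [^]\<^bsub>G Mod M\<^esub> (l + k)"
    using Q.H.int_pow_mult[OF Q.hom_closed] subsetD[OF c z(1)] unfolding k l by simp_all
  then show ?thesis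
    using c st by (simp only: commute_mod_Mod[OF M] subset_iff add.commute)
qed

text \<open>Every conjugation sends a generator of the cyclic factor to one of its powers, so any
  two conjugations commute on the factor and the derived subgroup acts trivially.\<close>

lemma derived_commute_cyclic_Mod:
  assumes M: "M \<lhd> G" and N: "N \<lhd> G" and MN: "M \<subseteq> N"
    and cyc: "cyclic_group (G\<lparr>carrier := N\<rparr> Mod M)"
    and f: "f \<in> derived G (carrier G)" and t: "t \<in> N"
  shows "commute_mod G M f t"
proof -
  interpret Q: group_hom G "G Mod M" "\<lambda>x. M #> x" by (rule group_hom_Mod) fact
  obtain z where z: "z \<in> N" "\<And>t. t \<in> N \<Longrightarrow> \<exists>k::int. M #> t = (M #> z) [^]\<^bsub>G Mod M\<^esub> k"
    using cyclic_Mod_generator[OF M N MN cyc] by blast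
  have c: "N \<subseteq> carrier G" using N normal_imp_subgroup subgroup.subset by blast
  have zc: "z \<in> carrier G" using c z by auto
  have "derived G (carrier G) \<subseteq> centralizer_mod G M z"
  proof (rule derived_subset_centralizer_mod[OF M zc subset_refl])
    fix g h assume gh: "g \<in> carrier G" "h \<in> carrier G"
    obtain k :: int where k: "M #> (inv g \<otimes> z \<otimes> g) = (M #> z) [^]\<^bsub>G Mod M\<^esub> k"
      using z(2)[OF normal.inv_op_closed1[OF N gh(1) z(1)]] ..
    obtain l :: int where l: "M #> (inv h \<otimes> z \<otimes> h) = (M #> z) [^]\<^bsub>G Mod M\<^esub> l"
      using z(2)[OF normal.inv_op_closed1[OF N gh(2) z(1)]] ..
    show "commute_mod G M z (g \<otimes> h \<otimes> inv g \<otimes> inv h)"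
      using Q.H.commutator_commutes_int_pow[of "M #> z" "M #> g" "M #> h" k l] gh zc
        k[symmetric] l[symmetric]
      by (simp add: commute_mod_Mod[OF M])
  qed
  \<comment> \<open>By symmetry the generator lies in the subgroup of elements commuting with
    \<open>f\<close> modulo \<open>M\<close>; hence so do its powers, which represent all of
    \<open>N\<close>.\<close>
  then have fc: "f \<in> carrier G" "z \<in> centralizer_mod G M f"
    using f zc by (auto simp: centralizer_mod_def commute_mod_sym[of G M z])
  have "(M #> z) [^]\<^bsub>G Mod M\<^esub> k \<in> (\<lambda>x. M #> x) ` centralizer_mod G M f" for k :: int
  proof -
    have "z [^] k \<in> centralizer_mod G M f"
      using subgroup_int_pow_closed[OF subgroup_centralizer_mod[OF M fc(1)] fc(2)] .
    then show ?thesis using Q.hom_int_pow[OF zc, of k] by (metis image_eqI)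
  qed
  then obtain s where s: "s \<in> centralizer_mod G M f" "M #> t = M #> s"
    using z(2)[OF t] by (metis imageE)
  then show ?thesis
    using fc t c by (auto simp: centralizer_mod_def commute_mod_Mod[OF M])
qed

text \<open>Crosses a single cyclic factor: the elements \<open>[y, g]\<close> lie in
  \<open>N\<close>, on which \<open>L\<close> acts trivially modulo \<open>M\<close>, and
  \<open>N\<close> is abelian modulo \<open>M\<close>.\<close>

lemma derived_centralizes_cyclic_Mod:
  assumes M: "M \<lhd> G" and N: "N \<lhd> G" and MN: "M \<subseteq> N"
    and cyc: "cyclic_group (G\<lparr>carrier := N\<rparr> Mod M)" and y: "y \<in> carrier G"
    and L: "L \<subseteq> derived G (carrier G)" and LN: "L \<subseteq> centralizer_mod G N y"
  shows "derived G L \<subseteq> centralizer_mod G M y"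
proof (rule derived_centralizes_translation[OF M y])
  show Lc: "L \<subseteq> carrier G" using L derived_in_carrier[of "carrier G"] by auto
  have u: "inv y \<otimes> inv g \<otimes> y \<otimes> g \<in> N" if "g \<in> L" for g
    using that LN Lc y by (auto simp: centralizer_mod_def commute_mod_iff[OF N] subset_iff)
  fix g h assume gh: "g \<in> L" "h \<in> L"
  show "commute_mod G M (inv y \<otimes> inv g \<otimes> y \<otimes> g) h"
    using derived_commute_cyclic_Mod[OF M N MN cyc _ u[OF gh(1)]] gh L
    by (subst commute_mod_sym) auto
  show "commute_mod G M (inv y \<otimes> inv g \<otimes> y \<otimes> g) (inv y \<otimes> inv h \<otimes> y \<otimes> h)"
    using cyclic_Mod_commute[OF M N MN cyc] u gh by auto
qed

section \<open>Products of conjugacy classes\<close>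

text \<open>Any factorization \<open>a \<otimes> b\<close> of an element of \<open>D\<close> can be
  conjugated so that \<open>b\<close> becomes \<open>y\<close>.\<close>

lemma conj_class_set_mult_cofactor:
  assumes A: "A \<in> conj_classes G" and B: "B \<in> conj_classes G" and D: "D \<in> conj_classes G"
    and sub: "D \<subseteq> A <#> B" and y: "y \<in> B"
  obtains x where "x \<in> A" "x \<otimes> y \<in> D"
proof -
  obtain d where d: "d \<in> D" using D conj_class_self unfolding conj_classes_def by auto
  then obtain a b where ab: "a \<in> A" "b \<in> B" "d = a \<otimes> b" using sub by (auto simp: set_mult_def)
  have c: "a \<in> carrier G" "b \<in> carrier G" using ab A B conj_classes_subset by auto
  obtain g where g: "g \<in> carrier G" "y = inv g \<otimes> b \<otimes> g"
    using y conj_class_eq[OF B ab(2)] unfolding conj_class_def by auto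
  have "(inv g \<otimes> a \<otimes> g) \<otimes> y \<in> D"
    using conj_class_closed[OF D d g(1)] unfolding ab(3) conj_mult[OF g(1) c] g(2) .
  then show thesis using that conj_class_closed[OF A ab(1) g(1)] by blast
qed

text \<open>\<open>D <#> N\<close> is invariant under conjugation, so a class that meets it lies
  inside it.\<close>

lemma conj_class_subset_set_mult_normal:
  assumes N: "N \<lhd> G" and D: "D \<in> conj_classes G" and E: "E \<in> conj_classes G"
    and e: "e \<in> E" "e \<in> D <#> N"
  shows "E \<subseteq> D <#> N"
proof
  fix z assume "z \<in> E"
  then obtain t where t: "t \<in> carrier G" "z = inv t \<otimes> e \<otimes> t"
    using conj_class_eq[OF E e(1)] unfolding conj_class_def by auto
  obtain d n where dn: "d \<in> D" "n \<in> N" "e = d \<otimes> n" using e(2) by (auto simp: set_mult_def)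
  have c: "d \<in> carrier G" "n \<in> carrier G"
    using dn conj_classes_subset[OF D] subgroup.subset[OF normal_imp_subgroup[OF N]] by auto
  show "z \<in> D <#> N"
    unfolding t(2) dn(3) conj_mult[OF t(1) c] set_mult_def
    using conj_class_closed[OF D dn(1) t(1)] normal.inv_op_closed1[OF N t(1) dn(2)] by auto
qed

text \<open>Crosses a whole gap at once: by \<open>no_new\<close>, \<open>[y, g]\<close> agrees
  modulo \<open>M\<close> with a quotient of two elements of \<open>D\<close>, and such quotients
  commute with everything that centralizes \<open>D\<close>.\<close>

lemma derived_centralizes_no_new_class:
  assumes A: "A \<in> conj_classes G" and B: "B \<in> conj_classes G" and D: "D \<in> conj_classes G"
    and sub: "D \<subseteq> A <#> B" and M: "M \<lhd> G" and N: "N \<lhd> G" and y: "y \<in> B"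
    and L: "L \<subseteq> centralizer G D" and LN: "L \<subseteq> centralizer_mod G N y"
    and no_new: "\<And>E. E \<in> conj_classes G \<Longrightarrow> E \<subseteq> A <#> B \<Longrightarrow> E \<subseteq> D <#> N \<Longrightarrow> E \<subseteq> D <#> M"
  shows "derived G L \<subseteq> centralizer_mod G M y"
proof -
  have Lc: "L \<subseteq> carrier G" using L by (auto simp: centralizer_def)
  have yc: "y \<in> carrier G" using y conj_classes_subset[OF B] by auto
  note DC = conj_classes_subset[OF D]
  note Mc = subgroup.subset[OF normal_imp_subgroup[OF M]]
  interpret C: normal "centralizer G D" G by (rule centralizer_conj_class_normal[OF D])
  obtain x where x: "x \<in> A" "x \<otimes> y \<in> D"
    using conj_class_set_mult_cofactor[OF A B D sub y] .
  have xc: "x \<in> carrier G" using x conj_classes_subset[OF A] by auto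
  \<comment> \<open>Needed for all \<open>w\<close> centralizing \<open>D\<close>, not only those in
    \<open>L\<close>: below, \<open>w\<close> is also taken to be \<open>[y, h]\<close>, which lies
    in \<open>centralizer G D\<close> by normality.\<close>
  have comm: "commute_mod G M (inv y \<otimes> inv g \<otimes> y \<otimes> g) w"
    if g: "g \<in> L" and w: "w \<in> centralizer G D" for g w
  proof -
    have gc: "g \<in> carrier G" and wc: "w \<in> carrier G" using g w Lc C.subset by auto
    define u where "u = inv y \<otimes> inv g \<otimes> y \<otimes> g"
    have uc: "u \<in> carrier G" using yc gc by (simp add: u_def)
    have uN: "u \<in> N"
      using g LN gc yc by (auto simp: centralizer_mod_def commute_mod_iff[OF N] u_def subset_iff)
    have xyu: "x \<otimes> y \<otimes> u = x \<otimes> (inv g \<otimes> y \<otimes> g)"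
    proof -
      have "y \<otimes> u = inv g \<otimes> y \<otimes> g"
        unfolding u_def using yc gc by (simp add: m_assoc[symmetric])
      then show ?thesis using xc yc uc by (simp add: m_assoc)
    qed
    have "x \<otimes> y \<otimes> u \<in> A <#> B"
      unfolding xyu set_mult_def using x(1) conj_class_closed[OF B y gc] by auto
    then obtain E where E: "E \<in> conj_classes G" "E \<subseteq> A <#> B" "x \<otimes> y \<otimes> u \<in> E"
      using conj_classes_Union[OF A B] by blast
    have "x \<otimes> y \<otimes> u \<in> D <#> N" using x(2) uN by (auto simp: set_mult_def)
    then have "E \<subseteq> D <#> M"
      using no_new E conj_class_subset_set_mult_normal[OF N D E(1,3)] by blast
    then obtain d m where dm: "d \<in> D" "m \<in> M" "x \<otimes> y \<otimes> u = d \<otimes> m"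
      using E(3) by (auto simp: set_mult_def)
    have dc: "d \<in> carrier G" "m \<in> carrier G" using dm DC Mc by auto
    have "inv (inv (x \<otimes> y) \<otimes> d) \<otimes> u = m"
      using dm(3) dc xc yc uc by (simp add: inv_mult_group m_assoc inv_solve_left')
    then have eq: "M #> u = M #> (inv (x \<otimes> y) \<otimes> d)"
      using rcos_eq_iff[OF M, of "inv (x \<otimes> y) \<otimes> d" u] dm(2) dc xc yc uc by auto
    have D': "z \<in> centralizer_mod G M w" if "z \<in> D" for z
    proof -
      have zc: "z \<in> carrier G" using that DC by auto
      have "inv w \<otimes> z \<otimes> w = z" using that w unfolding centralizer_def by blast
      then have "z \<otimes> w = w \<otimes> z" using conj_eq_iff[OF zc wc zc] by blast
      then show ?thesis using zc by (simp add: centralizer_mod_def commute_mod_def)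
    qed
    note sg = subgroup_centralizer_mod[OF M wc]
    have "inv (x \<otimes> y) \<otimes> d \<in> centralizer_mod G M w"
      using subgroup.m_closed[OF sg subgroup.m_inv_closed[OF sg D'[OF x(2)]] D'[OF dm(1)]] .
    then show ?thesis
      using eq uc wc xc yc dc unfolding u_def[symmetric]
      by (auto simp: centralizer_mod_def commute_mod_Mod[OF M])
  qed
  show ?thesis
  proof (rule derived_centralizes_translation[OF M yc Lc])
    fix g h assume gh: "g \<in> L" "h \<in> L"
    show "commute_mod G M (inv y \<otimes> inv g \<otimes> y \<otimes> g) h"
      using comm gh L by auto
    have "inv y \<otimes> inv h \<otimes> y \<otimes> h \<in> centralizer G D"
      using gh L yc C.inv_op_closed1[of y "inv h"] by auto
    then show "commute_mod G M (inv y \<otimes> inv g \<otimes> y \<otimes> g) (inv y \<otimes> inv h \<otimes> y \<otimes> h)"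
      using comm gh by auto
  qed
qed

lemma centralizer_mod_one: "y \<in> carrier G \<Longrightarrow> centralizer_mod G {\<one>} y = centralizer G {y}"
  using conj_eq_iff[of y _ y]
  by (auto simp: centralizer_mod_def centralizer_def commute_mod_def r_coset_def)

text \<open>Each \<open>x\<close> in \<open>A\<close> has a partner \<open>y\<close> in
  \<open>B\<close> with \<open>x \<otimes> y\<close> in \<open>D\<close>; what fixes
  \<open>x \<otimes> y\<close> and \<open>y\<close> also fixes \<open>x\<close>, by cancellation.
  Hence the descent only has to track \<open>B\<close>.\<close>

lemma centralizer_factor:
  assumes A: "A \<in> conj_classes G" and B: "B \<in> conj_classes G" and D: "D \<in> conj_classes G"
    and sub: "D \<subseteq> A <#> B"
  shows "centralizer G D \<inter> centralizer G B \<subseteq> centralizer G A"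
proof
  fix g assume g: "g \<in> centralizer G D \<inter> centralizer G B"
  then have gc: "g \<in> carrier G" by (simp add: centralizer_def)
  note Bc = conj_classes_subset[OF B] and Ac = conj_classes_subset[OF A]
  obtain b where b: "b \<in> B" using B conj_class_self unfolding conj_classes_def by auto
  obtain a where a: "a \<in> A" "a \<otimes> b \<in> D" using conj_class_set_mult_cofactor[OF A B D sub b] .
  have "inv g \<otimes> x \<otimes> g = x" if x: "x \<in> A" for x
  proof -
    obtain t where t: "t \<in> carrier G" "x = inv t \<otimes> a \<otimes> t"
      using x conj_class_eq[OF A a(1)] unfolding conj_class_def by auto
    define y where "y = inv t \<otimes> b \<otimes> t"
    have y: "y \<in> B" using conj_class_closed[OF B b t(1)] by (simp add: y_def)
    have c: "x \<in> carrier G" "y \<in> carrier G" "a \<in> carrier G" "b \<in> carrier G"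
      using x y a b Ac Bc by auto
    have "x \<otimes> y \<in> D"
      using conj_class_closed[OF D a(2) t(1)] unfolding conj_mult[OF t(1) c(3,4)] t(2) y_def .
    then have "(inv g \<otimes> x \<otimes> g) \<otimes> (inv g \<otimes> y \<otimes> g) = x \<otimes> y"
      using g conj_mult[OF gc c(1,2)] by (auto simp: centralizer_def)
    moreover have "inv g \<otimes> y \<otimes> g = y" using g y by (auto simp: centralizer_def)
    ultimately have "(inv g \<otimes> x \<otimes> g) \<otimes> y = x \<otimes> y" by (simp only:)
    then show ?thesis using c gc right_cancel[of y "inv g \<otimes> x \<otimes> g" x] by blast
  qed
  then show "g \<in> centralizer G A" using gc by (simp add: centralizer_def)
qed

section \<open>Derived length of a quotient\<close>

lemma exp_of_derived_incl:
  assumes "subgroup C G" shows "(derived G ^^ n) C \<subseteq> C"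
  by (induct n) (auto intro: subsetD[OF derived_incl[OF _ assms]])

text \<open>The derived series of \<open>C\<close> is the same computed in \<open>C\<close> or in
  \<open>G\<close>, and the projection maps it onto the derived series of the quotient.\<close>

lemma derived_length_Mod_le:
  assumes C: "subgroup C G" and K: "K \<lhd> G\<lparr>carrier := C\<rparr>" and n: "(derived G ^^ n) C \<subseteq> K"
  shows "derived_length (G\<lparr>carrier := C\<rparr> Mod K) \<le> enat n"
proof -
  let ?H = "G\<lparr>carrier := C\<rparr>"
  interpret H: group ?H using C by (rule subgroup_imp_group)
  interpret Q: group_hom ?H "?H Mod K" "\<lambda>x. K #>\<^bsub>?H\<^esub> x" by (rule H.group_hom_Mod[OF K])
  note sub = exp_of_derived_incl[OF C]
  have eq: "(derived ?H ^^ m) C = (derived G ^^ m) C" for m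
    by (induct m) (auto simp: derived_consistent[OF sub C])
  have "carrier (?H Mod K) = (\<lambda>x. K #>\<^bsub>?H\<^esub> x) ` carrier ?H"
    by (auto simp: FactGroup_def RCOSETS_def)
  then have "(derived (?H Mod K) ^^ n) (carrier (?H Mod K))
      = (derived (?H Mod K) ^^ n) ((\<lambda>x. K #>\<^bsub>?H\<^esub> x) ` carrier ?H)"
    by (simp only:)
  also have "\<dots> = (\<lambda>x. K #>\<^bsub>?H\<^esub> x) ` ((derived G ^^ n) C)"
    using Q.exp_of_derived_img[of "carrier ?H" n] eq by simp
  also have "\<dots> = {\<one>\<^bsub>?H Mod K\<^esub>}"
  proof -
    have "K #>\<^bsub>?H\<^esub> x = K" if "x \<in> (derived G ^^ n) C" for x
      using that n sub[of n] H.coset_join2[OF _ normal_imp_subgroup[OF K], of x] by auto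
    \<comment> \<open>Nonemptiness makes the image equal to the trivial subgroup, rather than merely
      contained in it.\<close>
    moreover have "\<one> \<in> (derived G ^^ n) C"
      using subgroup.one_closed[OF exp_of_derived_is_subgroup[OF C]] .
    ultimately show ?thesis by (auto simp: image_iff)
  qed
  finally show ?thesis
    unfolding derived_length_def by (intro INF_lower) simp
qed

section \<open>Descent along the normal series\<close>

lemma derived_centralizer_conj_class_prod:
  assumes fin: "finite (carrier G)" and ss: "supersolvable G"
    and A: "A \<in> conj_classes G" and B: "B \<in> conj_classes G" and D: "D \<in> conj_classes G"
    and sub: "D \<subseteq> A <#> B"
  shows "(derived G ^^ (2 * eta G (A <#> B))) (centralizer G D) \<subseteq> centralizer G B"
proof -
  obtain n N where N: "N 0 = {\<one>} \<and> N n = carrier G \<and> (\<forall>i\<le>n. N i \<lhd> G) \<and>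
    (\<forall>i<n. N i \<subseteq> N (Suc i) \<and> cyclic_group (G\<lparr>carrier := N (Suc i)\<rparr> Mod N i))"
    using ss unfolding supersolvable_def by (elim conjE exE) (rule that, intro conjI)
  then have N0: "N 0 = {\<one>}" and Nn: "N n = carrier G" and Nnorm: "\<And>i. i \<le> n \<Longrightarrow> N i \<lhd> G"
    and Nsub: "\<And>i. i < n \<Longrightarrow> N i \<subseteq> N (Suc i)"
    and Ncyc: "\<And>i. i < n \<Longrightarrow> cyclic_group (G\<lparr>carrier := N (Suc i)\<rparr> Mod N i)"
    by simp_all
  note DC = conj_classes_subset[OF D]
  interpret C: normal "centralizer G D" G by (rule centralizer_conj_class_normal[OF D])
  \<comment> \<open>The initial derived step: \<open>F\<close> lies both in
    \<open>centralizer G D\<close>, as gaps require, and in the derived subgroup of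
    \<open>G\<close>, as cyclic factors require.\<close>
  define F where "F = derived G (centralizer G D)"
  have sF: "subgroup F G" unfolding F_def using derived_is_subgroup C.subset by blast
  have FC: "F \<subseteq> centralizer G D" unfolding F_def using derived_incl C.subgroup_axioms by blast
  have FG: "F \<subseteq> derived G (carrier G)" unfolding F_def using mono_derived C.subset by blast
  note sub_F = exp_of_derived_incl[OF sF]
  have anti: "(derived G ^^ k) F \<subseteq> (derived G ^^ m) F" if "m \<le> k" for k m
    using that
  proof (induct k rule: dec_induct)
    case (step k)
    have "(derived G ^^ Suc k) F \<subseteq> (derived G ^^ k) F"
      using derived_incl[OF subset_refl exp_of_derived_is_subgroup[OF sF]] by simp
    with step show ?case by blast
  qed simp
  have mono: "N i \<subseteq> N j" if "i \<le> j" "j \<le> n" for i j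
    using that by (induct j rule: dec_induct) (use Nsub in \<open>auto dest: Suc_le_lessD\<close>)
  \<comment> \<open>\<open>card (R i)\<close> bounds the number of losses on the way from \<open>N n\<close> down to \<open>N i\<close>.\<close>
  define R where "R i = {E \<in> conj_classes G. E \<subseteq> A <#> B \<and> \<not> E \<subseteq> D <#> N i}" for i
  define K where "K i = {g \<in> carrier G. \<forall>y\<in>B. g \<in> centralizer_mod G (N i) y}" for i
  have "finite (conj_classes G)" using fin by (simp add: conj_classes_def)
  then have finR: "finite (R i)" for i by (simp add: R_def)
  have antiR: "R j \<subseteq> R i" if "i \<le> j" "j \<le> n" for i j
    unfolding R_def using mono_set_mult[OF subset_refl[of D] mono[OF that], of G] by blast
  have Kn: "F \<subseteq> K n"
  proof -
    have "commute_mod G (carrier G) y g" if "y \<in> carrier G" "g \<in> carrier G" for y g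
      using that commute_mod_iff[OF normal_self that] by simp
    then show ?thesis
      using conj_classes_subset[OF B] subgroup.subset[OF sF]
      by (auto simp: K_def Nn centralizer_mod_def subset_iff)
  qed
  \<comment> \<open>Each loss costs at most two steps, one for the cyclic factor where it happens
    and one for the gap below; the \<open>+ 1\<close> pays for the topmost gap. The induction runs
    downwards from \<open>n\<close>.\<close>
  have main: "(derived G ^^ (2 * card (R i) + 1)) F \<subseteq> K i" if "i \<le> n" for i
    using that
  proof (induct "n - i" arbitrary: i rule: less_induct)
    case less
    \<comment> \<open>\<open>N m\<close> is the top of the gap containing \<open>N i\<close>.\<close>
    define S where "S = {j. i \<le> j \<and> j \<le> n \<and> card (R j) = card (R i)}"
    have S: "finite S" "i \<in> S" using less.prems by (auto simp: S_def)
    define m where "m = Max S"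
    have mS: "m \<in> S" using S Max_in m_def by auto
    then have m: "i \<le> m" "m \<le> n" "card (R m) = card (R i)" by (auto simp: S_def)
    have "R m = R i" using card_subset_eq[OF finR antiR[OF m(1,2)] m(3)] .
    then have no_new: "E \<subseteq> D <#> N i"
      if "E \<in> conj_classes G" "E \<subseteq> A <#> B" "E \<subseteq> D <#> N m" for E
      using that by (auto simp: R_def)
    have Km: "(derived G ^^ (2 * card (R i))) F \<subseteq> K m"
    proof (cases "m = n")
      case True
      then show ?thesis using Kn sub_F by blast
    next
      case False
      then have mn: "m < n" using m by simp
      \<comment> \<open>By maximality of \<open>m\<close>, a class is lost between
        \<open>N (Suc m)\<close> and \<open>N m\<close>. If several are lost there, the surplus
        steps do no harm, by \<open>anti\<close>.\<close>
      have "Suc m \<notin> S" using Max_ge[OF S(1), of "Suc m"] m_def by auto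
      then have "card (R (Suc m)) \<noteq> card (R i)" using m mn by (auto simp: S_def)
      moreover have "card (R (Suc m)) \<le> card (R m)"
        using card_mono[OF finR antiR] mn by simp
      ultimately have lt: "2 * card (R (Suc m)) + 2 \<le> 2 * card (R i)" using m by simp
      let ?L = "(derived G ^^ (2 * card (R (Suc m)) + 1)) F"
      have L: "?L \<subseteq> K (Suc m)" using less.hyps[of "Suc m"] m mn by simp
      have Lc: "derived G ?L \<subseteq> carrier G"
        using derived_in_carrier exp_of_derived_in_carrier subgroup.subset[OF sF] by blast
      have "derived G ?L \<subseteq> centralizer_mod G (N m) y" if y: "y \<in> B" for y
      proof (rule derived_centralizes_cyclic_Mod[OF Nnorm Nnorm Nsub[OF mn] Ncyc[OF mn]])
        show "?L \<subseteq> derived G (carrier G)" using sub_F FG by blast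
        show "?L \<subseteq> centralizer_mod G (N (Suc m)) y" using L y by (auto simp: K_def)
      qed (use mn y conj_classes_subset[OF B] in auto)
      then have "derived G ?L \<subseteq> K m" using Lc by (auto simp: K_def)
      moreover have "(derived G ^^ (2 * card (R i))) F \<subseteq> (derived G ^^ (2 * card (R (Suc m)) + 2)) F"
        by (rule anti[OF lt])
      ultimately show ?thesis by auto
    qed
    let ?L = "(derived G ^^ (2 * card (R i))) F"
    have Lc: "derived G ?L \<subseteq> carrier G"
      using derived_in_carrier exp_of_derived_in_carrier subgroup.subset[OF sF] by blast
    have "derived G ?L \<subseteq> centralizer_mod G (N i) y" if y: "y \<in> B" for y
    proof (rule derived_centralizes_no_new_class[OF A B D sub Nnorm Nnorm y _ _ no_new])
      show "?L \<subseteq> centralizer G D" using sub_F FC by blast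
      show "?L \<subseteq> centralizer_mod G (N m) y" using Km y by (auto simp: K_def)
    qed (use m in auto)
    then show ?case using Lc by (auto simp: K_def)
  qed
  \<comment> \<open>As \<open>N 0\<close> is trivial, \<open>D <#> N 0\<close> is \<open>D\<close>.
    So at least one class in \<open>A <#> B\<close> survives, which leaves room for the step into
    \<open>F\<close>.\<close>
  have DR: "D \<notin> R 0"
    using DC by (auto simp: R_def N0 set_mult_def subset_iff)
  have "card (R 0) < eta G (A <#> B)"
    unfolding eta_def
  proof (rule psubset_card_mono)
    show "finite {C \<in> conj_classes G. C \<subseteq> A <#> B}"
      using \<open>finite (conj_classes G)\<close> by simp
    show "R 0 \<subset> {C \<in> conj_classes G. C \<subseteq> A <#> B}"
      using DR D sub by (auto simp: R_def)
  qed
  then have le: "2 * card (R 0) + 1 \<le> 2 * eta G (A <#> B) - 1" "0 < eta G (A <#> B)" by auto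
  \<comment> \<open>The innermost application of \<open>derived G\<close> produces \<open>F\<close>;
    positivity of \<open>eta\<close> makes the natural subtraction exact.\<close>
  have "(derived G ^^ (2 * eta G (A <#> B))) (centralizer G D) = (derived G ^^ (2 * eta G (A <#> B) - 1)) F"
    using le(2) unfolding F_def by (cases "2 * eta G (A <#> B)") (auto simp: funpow_swap1)
  also have "\<dots> \<subseteq> K 0" using anti[OF le(1)] main[of 0] by blast
  also have "K 0 \<subseteq> centralizer G B"
  proof
    fix g assume g: "g \<in> K 0"
    have "g \<in> centralizer G {y}" if "y \<in> B" for y
      using g that centralizer_mod_one[of y] conj_classes_subset[OF B]
      unfolding K_def N0 by blast
    with g show "g \<in> centralizer G B" unfolding K_def centralizer_def by blast
  qed
  finally show ?thesis .
qed

end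

theorem theoremB:
  fixes G :: "('a, 'b) monoid_scheme" (structure)
  assumes "group G" and "finite (carrier G)" and "supersolvable G"
    and "A \<in> conj_classes G" and "B \<in> conj_classes G" and "D \<in> conj_classes G"
    and "D \<subseteq> A <#> B"
  shows "derived_length (G\<lparr>carrier := centralizer G D\<rparr> Mod (centralizer G A \<inter> centralizer G B))
           \<le> enat (2 * eta G (A <#> B))"
proof -
  interpret group G by fact
  interpret C: normal "centralizer G D" G by (rule centralizer_conj_class_normal) fact
  \<comment> \<open>The derived series also stays inside \<open>centralizer G D\<close>, which lets
    \<open>centralizer_factor\<close> pass from \<open>B\<close> to \<open>A\<close>.\<close>
  have "(derived G ^^ (2 * eta G (A <#> B))) (centralizer G D) \<subseteq> centralizer G A \<inter> centralizer G B"
    using derived_centralizer_conj_class_prod[OF assms(2-7)] centralizer_factor[OF assms(4-7)]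
      exp_of_derived_incl[OF C.subgroup_axioms] by blast
  then show ?thesis
    using derived_length_Mod_le[OF C.subgroup_axioms centralizer_Int_normal] assms(4-7) by blast
qed

end
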